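(* Let $m,k>0$, let $r\ge1$ be an integer, and let $(P_t)_{t\in\mathcal T}$ be an $(m,k)$-ranked-spread indexed system of subsets of a finite set $U$, with distribution $\mu$ on the finite set $\mathcal T$, such that $|P_t|\le r$ for every $t\in\mathcal T$. Let $\mathcal A\subseteq\mathcal T$, put $\tau=\mu(\mathcal A)$, let $\alpha>0$ be such that $p=\frac{\alpha}{k}\le1$, and let $W\subseteq U$ be the random set containing each element of $U$ independently with probability $p$. Define $$X_{\mathcal A}=\sum_{t\in\mathcal A}\mu(t)\,p^{-|P_t|}\,\mathbf 1_{\{P_t\subseteq W\}},\qquad H_r(\alpha)=\sum_{i=1}^r\alpha^{-i}.$$ Then $\mathbb E X_{\mathcal A}=\tau$, $\operatorname{Var}(X_{\mathcal A})\le\tau mH_r(\alpha)$, and, for every $\eta\in[0,1]$, $$\mathbb P\bigl[X_{\mathcal A}\le(1-\eta)\tau\bigr]\le\exp\left(-\frac{\eta^2\tau}{2mH_r(\alpha)}\right).$$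
   Context: A weighted indexed set system consists of a finite set $\mathcal T$ with a probability distribution $\mu$ and a set $P_t\subseteq U$ for each $t\in\mathcal T$ (different indices may carry the same set). It is $(m,k)$-ranked-spread if every nonempty $P_t$ admits an ordering $P_t=\{x_1(t),\ldots,x_{|P_t|}(t)\}$ such that, for every $i\in\{1,\dots,|P_t|\}$, $\mu(\{s\in\mathcal T: x_i(t)\in P_s\})\le m k^{-i}$. The ordering may depend on $t$. *)

theory Defs
  imports "HOL-Probability.Probability" "HOL-Probability.Product_PMF"
begin

text \<open>The probability distribution on the finite index set \<open>T\<close> is a pmf supported in \<open>T\<close>;
  indices of mass zero are allowed.  The family \<open>P\<close> need not be injective, and its values
  outside \<open>T\<close> are irrelevant.\<close>

definition weighted_set_system :: "'a set \<Rightarrow> 't set \<Rightarrow> 't pmf \<Rightarrow> ('t \<Rightarrow> 'a set) \<Rightarrow> bool" where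
  "weighted_set_system U T \<mu> P \<longleftrightarrow> finite T \<and> set_pmf \<mu> \<subseteq> T \<and> (\<forall>t\<in>T. P t \<subseteq> U)"

definition ranked_spread :: "real \<Rightarrow> real \<Rightarrow> 't set \<Rightarrow> 't pmf \<Rightarrow> ('t \<Rightarrow> 'a set) \<Rightarrow> bool" where
  "ranked_spread m k T \<mu> P \<longleftrightarrow>
     (\<forall>t\<in>T. P t \<noteq> {} \<longrightarrow>
        (\<exists>x. bij_betw x {1..card (P t)} (P t) \<and>
             (\<forall>i\<in>{1..card (P t)}.
                measure_pmf.prob \<mu> {s\<in>T. x i \<in> P s} \<le> m * k powi (- int i))))"

text \<open>The law of the random subset of a finite set \<open>U\<close> that contains each element
  independently with probability \<open>p\<close>.\<close>

definition random_subset_pmf :: "'a set \<Rightarrow> real \<Rightarrow> 'a set pmf" where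
  "random_subset_pmf U p =
     map_pmf (\<lambda>f. {u\<in>U. f u}) (Pi_pmf U False (\<lambda>_. bernoulli_pmf p))"

definition weighted_count :: "'t pmf \<Rightarrow> ('t \<Rightarrow> 'a set) \<Rightarrow> real \<Rightarrow> 't set \<Rightarrow> 'a set \<Rightarrow> real" where
  "weighted_count \<mu> P p A W =
     (\<Sum>t\<in>A. pmf \<mu> t * p powi (- int (card (P t))) * of_bool (P t \<subseteq> W))"

definition H_sum :: "nat \<Rightarrow> real \<Rightarrow> real" where
  "H_sum r \<alpha> = (\<Sum>i=1..r. \<alpha> powi (- int i))"

end

theory Submission
  imports Defs
begin

text \<open>Everything is controlled by the overlap sum \<open>\<Delta>\<close>, the sum of \<open>\<mu>(s) \<mu>(t) / p ^ card (P s \<inter> P t)\<close>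
  over the pairs \<open>s, t\<close> in \<open>A\<close> with \<open>P s \<inter> P t \<noteq> {}\<close>: it bounds the variance, and the lower tail is
  a weighted Janson inequality with this \<open>\<Delta>\<close>.
  If \<open>j\<close> is the largest rank in \<open>P t\<close> of an element of \<open>P s \<inter> P t\<close>, then the intersection has at
  most \<open>j\<close> elements, so \<open>1 / p ^ card (P s \<inter> P t)\<close> is at most \<open>1 / p ^ j\<close>, hence at most the sum of
  \<open>1 / p ^ i\<close> over all ranks \<open>i\<close> with \<open>x i \<in> P s\<close>. Averaging over \<open>s\<close> gives \<open>\<Delta> \<le> \<tau> m H\<^sub>r(\<alpha>)\<close>.\<close>

section \<open>Expectations over a random subset: conditioning on one element, Harris' inequality,
  independence\<close>

lemma finite_set_random_subset_pmf: "finite U \<Longrightarrow> finite (set_pmf (random_subset_pmf U p))"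
  by (rule finite_subset[of _ "Pow U"]) (auto simp: random_subset_pmf_def)

lemma integrable_random_subset_pmf [intro, simp]:
  fixes f :: "'a set \<Rightarrow> real"
  shows "finite U \<Longrightarrow> integrable (measure_pmf (random_subset_pmf U p)) f"
  by (simp add: finite_set_random_subset_pmf integrable_measure_pmf_finite)

abbreviation subset_expectation :: "'a set \<Rightarrow> real \<Rightarrow> ('a set \<Rightarrow> real) \<Rightarrow> real" where
  "subset_expectation U p \<equiv> measure_pmf.expectation (random_subset_pmf U p)"

lemma subset_expectation_mono:
  assumes "finite U" "\<And>W. f W \<le> g W"
  shows "subset_expectation U p f \<le> subset_expectation U p g"
  using assms by (intro integral_mono) auto

lemma random_subset_pmf_insert:
  assumes "finite U" "u \<notin> U"
  shows "random_subset_pmf (insert u U) p =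
    bernoulli_pmf p \<bind> (\<lambda>b. map_pmf (\<lambda>W. if b then insert u W else W) (random_subset_pmf U p))"
proof -
  have "{v \<in> insert u U. (f(u := b)) v} =
      (if b then insert u {v \<in> U. f v} else {v \<in> U. f v})" for f b
    using assms by auto
  then show ?thesis
    using assms unfolding random_subset_pmf_def
    by (simp add: Pi_pmf_insert' map_bind_pmf map_pmf_comp map_pmf_def[symmetric]
        del: fun_upd_apply)
qed

text \<open>Conditioning on whether \<open>u\<close> is chosen. This recursion drives the inductions
  below, so product measures need not appear again.\<close>

lemma subset_expectation_insert:
  assumes "finite U" "u \<notin> U" "0 \<le> p" "p \<le> 1"
  shows "subset_expectation (insert u U) p f =
    p * subset_expectation U p (\<lambda>W. f (insert u W)) + (1 - p) * subset_expectation U p f"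
  unfolding random_subset_pmf_insert[OF assms(1,2)]
  using assms
  by (subst pmf_expectation_bind[where A = UNIV])
     (auto simp: finite_set_random_subset_pmf UNIV_bool)

text \<open>Induction on \<open>U\<close>: conditioned on the new element, both functions keep their
  monotonicity, so the induction hypothesis handles each of the two cases. What remains is
  Chebyshev's sum inequality on a two-point space, for the four conditional means.\<close>

lemma subset_expectation_harris:
  fixes f g :: "'a set \<Rightarrow> real"
  assumes "finite U" "0 \<le> p" "p \<le> 1" "antimono f" "mono g"
  shows "subset_expectation U p (\<lambda>W. f W * g W) \<le> subset_expectation U p f * subset_expectation U p g"
  using assms(1,4,5)
proof (induction U arbitrary: f g)
  case empty
  then show ?case
    by (simp add: random_subset_pmf_def)
next
  case (insert u U)
  let ?E = "subset_expectation U p"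
  define a0 a1 b0 b1 where "a0 = ?E f" "a1 = ?E (\<lambda>W. f (insert u W))"
    "b0 = ?E g" "b1 = ?E (\<lambda>W. g (insert u W))"
  note defs = this
  have "antimono (\<lambda>W. f (insert u W))" "mono (\<lambda>W. g (insert u W))"
    using insert.prems by (simp_all add: monotone_on_def insert_mono subset_insertI2)
  from insert.IH[OF this] have 1: "?E (\<lambda>W. f (insert u W) * g (insert u W)) \<le> a1 * b1"
    by (simp add: defs)
  have 0: "?E (\<lambda>W. f W * g W) \<le> a0 * b0"
    using insert.IH insert.prems by (simp add: defs)
  have "a1 \<le> a0"
    unfolding defs using insert.hyps
    by (intro subset_expectation_mono antimonoD[OF insert.prems(1)]) auto
  moreover have "b0 \<le> b1"
    unfolding defs using insert.hyps
    by (intro subset_expectation_mono monoD[OF insert.prems(2)]) auto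
  \<comment> \<open>This product is exactly the right side minus the left side of the two-point
    inequality that follows.\<close>
  ultimately have "0 \<le> p * (1 - p) * ((a0 - a1) * (b1 - b0))"
    using assms by (intro mult_nonneg_nonneg) auto
  then have "p * (a1 * b1) + (1 - p) * (a0 * b0) \<le> (p * a1 + (1 - p) * a0) * (p * b1 + (1 - p) * b0)"
    by (simp add: algebra_simps)
  moreover have "p * ?E (\<lambda>W. f (insert u W) * g (insert u W)) + (1 - p) * ?E (\<lambda>W. f W * g W)
      \<le> p * (a1 * b1) + (1 - p) * (a0 * b0)"
    using assms by (intro add_mono mult_left_mono 0 1) auto
  ultimately show ?case
    using insert.hyps assms by (simp add: subset_expectation_insert defs)
qed

text \<open>The event \<open>S \<subseteq> W\<close> depends only on the coordinates in
  \<open>S\<close>, and \<open>g\<close> ignores them, so the two factors are independent. The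
  elements of \<open>S\<close> are removed one at a time, each contributing a factor
  \<open>p\<close>.\<close>

lemma subset_expectation_contains:
  assumes "finite U" "0 \<le> p" "p \<le> 1" "S \<subseteq> U"
    and g: "\<And>u W. u \<in> S \<Longrightarrow> g (insert u W) = g W"
  shows "subset_expectation U p (\<lambda>W. of_bool (S \<subseteq> W) * g W) = p ^ card S * subset_expectation U p g"
proof -
  have "finite S"
    using assms finite_subset by blast
  then show ?thesis
    using assms(4) g
  proof (induction S)
    case (insert u S)
    define V where "V = U - {u}"
    have U: "U = insert u V" "u \<notin> V" "finite V"
      using insert.prems assms by (auto simp: V_def)
    have "subset_expectation U p (\<lambda>W. of_bool (insert u S \<subseteq> W) * g W)
        = p * subset_expectation V p (\<lambda>W. of_bool (S \<subseteq> W) * g W)"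
    proof -
      \<comment> \<open>A random subset of \<open>V\<close> never contains \<open>u\<close>, so the
        branch in which \<open>u\<close> is not chosen vanishes.\<close>
      have "subset_expectation V p (\<lambda>W. of_bool (insert u S \<subseteq> W) * g W) =
          subset_expectation V p (\<lambda>_. 0)"
        using U by (intro integral_cong_AE)
          (auto simp: AE_measure_pmf_iff random_subset_pmf_def)
      moreover have "S \<subseteq> insert u W \<longleftrightarrow> S \<subseteq> W" for W
        using insert.hyps by auto
      ultimately show ?thesis
        using U assms insert.prems by (simp add: subset_expectation_insert)
    qed
    \<comment> \<open>Neither \<open>S\<close> nor \<open>g\<close> sees \<open>u\<close>, so both
      branches agree and \<open>u\<close> can be put back into the ground set; this keeps
      \<open>U\<close> fixed during the induction.\<close>
    also have "subset_expectation V p (\<lambda>W. of_bool (S \<subseteq> W) * g W) =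
        subset_expectation U p (\<lambda>W. of_bool (S \<subseteq> W) * g W)"
    proof -
      have "S \<subseteq> insert u W \<longleftrightarrow> S \<subseteq> W" for W
        using insert.hyps by auto
      then show ?thesis
        using U assms insert.prems by (simp add: subset_expectation_insert algebra_simps)
    qed
    finally show ?case
      using insert by simp
  qed simp
qed

lemma subset_expectation_subset:
  assumes "finite U" "0 \<le> p" "p \<le> 1" "S \<subseteq> U"
  shows "subset_expectation U p (\<lambda>W. of_bool (S \<subseteq> W)) = p ^ card S"
  using subset_expectation_contains[OF assms, of "\<lambda>_. 1"] by simp

lemma subset_expectation_subset2:
  assumes "finite U" "0 \<le> p" "p \<le> 1" "S \<subseteq> U" "R \<subseteq> U"
  shows "subset_expectation U p (\<lambda>W. of_bool (S \<subseteq> W \<and> R \<subseteq> W)) = p ^ card (S \<union> R)"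
  using subset_expectation_subset[of U p "S \<union> R"] assms by simp

section \<open>Weighted containment sums: moments, Laplace transform and lower tail\<close>

definition weighted_containment :: "'t set \<Rightarrow> ('t \<Rightarrow> real) \<Rightarrow> ('t \<Rightarrow> 'a set) \<Rightarrow> 'a set \<Rightarrow> real" where
  "weighted_containment A c S W = (\<Sum>t\<in>A. c t * of_bool (S t \<subseteq> W))"

lemma expectation_weighted_containment:
  assumes "finite U" "0 \<le> p" "p \<le> 1" "\<And>t. t \<in> A \<Longrightarrow> S t \<subseteq> U"
  shows "subset_expectation U p (weighted_containment A c S) = (\<Sum>t\<in>A. c t * p ^ card (S t))"
  using assms unfolding weighted_containment_def
  by (simp add: subset_expectation_subset)

lemma expectation_weighted_containment_square:
  assumes "finite U" "0 \<le> p" "p \<le> 1" "\<And>t. t \<in> A \<Longrightarrow> S t \<subseteq> U"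
  shows "subset_expectation U p (\<lambda>W. (weighted_containment A c S W)\<^sup>2) =
    (\<Sum>t\<in>A. \<Sum>s\<in>A. c t * c s * p ^ card (S t \<union> S s))"
proof -
  have "(weighted_containment A c S W)\<^sup>2 =
      (\<Sum>t\<in>A. \<Sum>s\<in>A. c t * c s * of_bool (S t \<subseteq> W \<and> S s \<subseteq> W))" for W
    unfolding weighted_containment_def power2_eq_square sum_product
    by (intro sum.cong refl) auto
  then show ?thesis
    using assms by (simp add: subset_expectation_subset2 del: of_bool_conj)
qed

lemma mono_weighted_containment:
  assumes "\<And>t. t \<in> A \<Longrightarrow> 0 \<le> c t"
  shows "mono (weighted_containment A c S)"
  unfolding weighted_containment_def
  using assms by (intro monoI sum_mono mult_left_mono) auto

text \<open>The differential inequality \<open>- \<Psi>'(s) \<ge> (\<tau> - s \<Delta>) \<Psi>(s)\<close> for the Laplace transform \<open>\<Psi>\<close>, one summand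
  at a time. The part of the sum that overlaps \<open>S t\<close> is estimated by \<open>exp (- x) \<ge> 1 - x\<close> and Harris'
  inequality, the other part is independent of \<open>S t \<subseteq> W\<close>.\<close>
lemma laplace_weighted_containment_summand:
  fixes c :: "'t \<Rightarrow> real" and s :: real
  assumes U: "finite U" and p: "0 \<le> p" "p \<le> 1" and A: "finite A" "\<And>t. t \<in> A \<Longrightarrow> S t \<subseteq> U"
    and c: "\<And>t. t \<in> A \<Longrightarrow> 0 \<le> c t" and t: "t \<in> A" and s: "0 \<le> s"
  shows "(p ^ card (S t) - s * (\<Sum>u\<in>{u \<in> A. S t \<inter> S u \<noteq> {}}. c u * p ^ card (S t \<union> S u))) *
      subset_expectation U p (\<lambda>W. exp (- s * weighted_containment A c S W))
    \<le> subset_expectation U p (\<lambda>W. of_bool (S t \<subseteq> W) * exp (- s * weighted_containment A c S W))"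
    (is "?a * ?\<Psi> \<le> ?R")
proof -
  let ?E = "subset_expectation U p"
  \<comment> \<open>\<open>Y\<close> collects the sets meeting \<open>S t\<close>, including
    \<open>S t\<close> itself when it is nonempty; \<open>Z\<close> collects those disjoint from
    it.\<close>
  define B where "B = {u \<in> A. S t \<inter> S u \<noteq> {}}"
  define X Y Z where "X = weighted_containment A c S" "Y = weighted_containment B c S"
    "Z = weighted_containment (A - B) c S"
  note XYZ = this
  have BA: "B \<subseteq> A"
    by (auto simp: B_def)
  have X: "X W = Y W + Z W" for W
    unfolding XYZ weighted_containment_def by (subst sum.subset_diff[OF BA A(1)]) simp
  have nonneg: "0 \<le> Y W" "0 \<le> Z W" for W
    using c BA by (auto simp: XYZ weighted_containment_def intro!: sum_nonneg mult_nonneg_nonneg)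
  have mono: "mono Y" "mono Z"
    using c BA unfolding XYZ by (auto intro!: mono_weighted_containment)
  show ?thesis
  \<comment> \<open>For \<open>?a \<le> 0\<close> the claim only compares signs. Otherwise
    \<open>?a\<close> is positive, so replacing \<open>?\<Psi>\<close> by the larger mean of
    \<open>exp (- s * Z W)\<close> enlarges the left side.\<close>
  proof (cases "?a \<le> 0")
    case True
    have "0 \<le> ?R" "0 \<le> ?\<Psi>"
      by (intro integral_nonneg_AE; simp)+
    then show ?thesis
      using mult_nonpos_nonneg[OF True, of ?\<Psi>] by linarith
  next
    case False
    let ?e = "\<lambda>W. exp (- s * Z W)"
    have EY: "?E (\<lambda>W. of_bool (S t \<subseteq> W) * Y W) = (\<Sum>u\<in>B. c u * p ^ card (S t \<union> S u))"
    proof -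
      have "of_bool (S t \<subseteq> W) * Y W = (\<Sum>u\<in>B. c u * of_bool (S t \<subseteq> W \<and> S u \<subseteq> W))" for W
        unfolding XYZ weighted_containment_def sum_distrib_left by (intro sum.cong) auto
      then show ?thesis
        using U p A t BA by (simp add: subset_expectation_subset2 subsetD del: of_bool_conj)
    qed
    have "antimono ?e"
      using s monoD[OF mono(2)] by (auto intro!: antimonoI mult_left_mono)
    moreover have "mono (\<lambda>W. of_bool (S t \<subseteq> W) * Y W)"
      using nonneg monoD[OF mono(1)] by (intro monoI mult_mono) auto
    ultimately have H: "?E (\<lambda>W. ?e W * (of_bool (S t \<subseteq> W) * Y W))
        \<le> ?E ?e * (\<Sum>u\<in>B. c u * p ^ card (S t \<union> S u))"
      unfolding EY[symmetric] by (intro subset_expectation_harris[OF U p])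
    have "Z (insert v W) = Z W" if "v \<in> S t" for v W
    proof -
      have "S u \<subseteq> insert v W \<longleftrightarrow> S u \<subseteq> W" if "u \<in> A - B" for u
        using that \<open>v \<in> S t\<close> by (auto simp: B_def)
      then show ?thesis
        unfolding XYZ weighted_containment_def by (intro sum.cong) auto
    qed
    then have I: "?E (\<lambda>W. of_bool (S t \<subseteq> W) * ?e W) = p ^ card (S t) * ?E ?e"
      using U p A t by (intro subset_expectation_contains) auto
    have "?a * ?\<Psi> \<le> ?a * ?E ?e"
      using False U s nonneg X
      by (intro mult_left_mono subset_expectation_mono) (auto simp: XYZ(1)[symmetric] mult_left_mono)
    also have "\<dots> \<le> ?E (\<lambda>W. of_bool (S t \<subseteq> W) * ?e W) - s * ?E (\<lambda>W. ?e W * (of_bool (S t \<subseteq> W) * Y W))"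
      using mult_left_mono[OF H s] unfolding I B_def[symmetric] by (simp add: algebra_simps)
    also have "\<dots> = ?E (\<lambda>W. of_bool (S t \<subseteq> W) * ?e W - s * (?e W * (of_bool (S t \<subseteq> W) * Y W)))"
      using U by (subst Bochner_Integration.integral_diff) auto
    also have "\<dots> = ?E (\<lambda>W. of_bool (S t \<subseteq> W) * ?e W * (1 - s * Y W))"
      by (intro Bochner_Integration.integral_cong) (simp_all add: algebra_simps)
    also have "\<dots> \<le> ?R"
    proof (intro subset_expectation_mono U)
      fix W
      have "1 - s * Y W \<le> exp (- s * Y W)"
        using exp_ge_add_one_self[of "- s * Y W"] by simp
      then have "of_bool (S t \<subseteq> W) * ?e W * (1 - s * Y W) \<le> of_bool (S t \<subseteq> W) * ?e W * exp (- s * Y W)"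
        by (intro mult_left_mono) auto
      then show "of_bool (S t \<subseteq> W) * ?e W * (1 - s * Y W)
          \<le> of_bool (S t \<subseteq> W) * exp (- s * weighted_containment A c S W)"
        unfolding XYZ(1)[symmetric] X ring_distribs(1) exp_add by (simp add: mult_ac)
    qed
    finally show ?thesis .
  qed
qed

text \<open>Summing the one-summand estimates with weights \<open>c t\<close> gives the differential
  inequality, which an integrating factor turns into a bound on the transform.\<close>

lemma laplace_weighted_containment:
  fixes c :: "'t \<Rightarrow> real" and s \<Delta> :: real
  assumes U: "finite U" and p: "0 \<le> p" "p \<le> 1" and A: "finite A" "\<And>t. t \<in> A \<Longrightarrow> S t \<subseteq> U"
    and c: "\<And>t. t \<in> A \<Longrightarrow> 0 \<le> c t" and s: "0 \<le> s"
    and \<tau>: "\<tau> = (\<Sum>t\<in>A. c t * p ^ card (S t))"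
    and \<Delta>: "(\<Sum>t\<in>A. \<Sum>u\<in>{u \<in> A. S t \<inter> S u \<noteq> {}}. c t * c u * p ^ card (S t \<union> S u)) \<le> \<Delta>"
  shows "subset_expectation U p (\<lambda>W. exp (- s * weighted_containment A c S W))
    \<le> exp (s\<^sup>2 * \<Delta> / 2 - s * \<tau>)"
proof -
  let ?E = "subset_expectation U p"
  let ?X = "weighted_containment A c S"
  let ?D = "set_pmf (random_subset_pmf U p)"
  define \<Psi> where "\<Psi> x = ?E (\<lambda>W. exp (- x * ?X W))" for x
  \<comment> \<open>The factor is the exponential of the integral of
    \<open>\<tau> - y * \<Delta>\<close> over \<open>y\<close> from 0 to \<open>x\<close>, so the
    differential inequality says that \<open>G\<close> does not increase; moreover
    \<open>G 0 = 1\<close>.\<close>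
  define G where "G x = \<Psi> x * exp (x * \<tau> - x\<^sup>2 * \<Delta> / 2)" for x
  \<comment> \<open>As a finite sum the expectation can be differentiated term by term.\<close>
  have sum: "?E f = (\<Sum>W\<in>?D. pmf (random_subset_pmf U p) W * f W)" for f
    using finite_set_random_subset_pmf[OF U]
    by (subst integral_measure_pmf[of ?D]) auto
  have deriv: "(\<Psi> has_real_derivative - ?E (\<lambda>W. ?X W * exp (- x * ?X W))) (at x)" for x
    unfolding \<Psi>_def sum
    by (auto intro!: derivative_eq_intros sum.cong simp: sum_negf[symmetric])
  have ineq: "(\<tau> - x * \<Delta>) * \<Psi> x \<le> ?E (\<lambda>W. ?X W * exp (- x * ?X W))" if "0 \<le> x" for x
  proof -
    let ?b = "\<lambda>t. \<Sum>u\<in>{u \<in> A. S t \<inter> S u \<noteq> {}}. c u * p ^ card (S t \<union> S u)"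
    have "(\<Sum>t\<in>A. c t * ?b t) \<le> \<Delta>"
      using \<Delta> by (simp add: sum_distrib_left mult.assoc)
    then have "\<tau> - x * \<Delta> \<le> (\<Sum>t\<in>A. c t * p ^ card (S t)) - x * (\<Sum>t\<in>A. c t * ?b t)"
      using that \<tau> by (simp add: mult_left_mono)
    also have "\<dots> = (\<Sum>t\<in>A. c t * (p ^ card (S t) - x * ?b t))"
      by (simp add: sum_distrib_left sum_subtractf algebra_simps)
    finally have "(\<tau> - x * \<Delta>) * \<Psi> x \<le> (\<Sum>t\<in>A. c t * (p ^ card (S t) - x * ?b t)) * \<Psi> x"
      by (intro mult_right_mono) (auto simp: \<Psi>_def)
    also have "\<dots> = (\<Sum>t\<in>A. c t * ((p ^ card (S t) - x * ?b t) * \<Psi> x))"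
      by (simp add: sum_distrib_right mult.assoc)
    also have "\<dots> \<le> (\<Sum>t\<in>A. c t * ?E (\<lambda>W. of_bool (S t \<subseteq> W) * exp (- x * ?X W)))"
      unfolding \<Psi>_def using U p A c that
      by (intro sum_mono mult_left_mono laplace_weighted_containment_summand) auto
    also have "\<dots> = ?E (\<lambda>W. \<Sum>t\<in>A. c t * (of_bool (S t \<subseteq> W) * exp (- x * ?X W)))"
      using U by simp
    also have "\<dots> = ?E (\<lambda>W. ?X W * exp (- x * ?X W))"
      by (intro Bochner_Integration.integral_cong refl)
         (simp add: weighted_containment_def sum_distrib_right mult.assoc)
    finally show ?thesis .
  qed
  have "G s \<le> G 0"
  proof (rule DERIV_nonpos_imp_nonincreasing[OF s])
    fix x :: real assume x: "0 \<le> x"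
    let ?G' = "((\<tau> - x * \<Delta>) * \<Psi> x - ?E (\<lambda>W. ?X W * exp (- x * ?X W))) * exp (x * \<tau> - x\<^sup>2 * \<Delta> / 2)"
    have "(G has_real_derivative ?G') (at x)"
      unfolding G_def by (auto intro!: derivative_eq_intros deriv simp: algebra_simps)
    moreover have "?G' \<le> 0"
      using ineq[OF x] by (intro mult_nonpos_nonneg) auto
    ultimately show "\<exists>y. (G has_real_derivative y) (at x) \<and> y \<le> 0"
      by blast
  qed
  then have "\<Psi> s * exp (s * \<tau> - s\<^sup>2 * \<Delta> / 2) \<le> 1"
    by (simp add: G_def \<Psi>_def)
  then have "\<Psi> s \<le> 1 / exp (s * \<tau> - s\<^sup>2 * \<Delta> / 2)"
    by (simp add: field_simps)
  then show ?thesis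
    by (simp add: \<Psi>_def exp_diff)
qed

text \<open>The exponential Markov inequality applied to the Laplace bound.\<close>

lemma janson_lower_tail:
  fixes c :: "'t \<Rightarrow> real" and \<Delta> l :: real
  assumes U: "finite U" and p: "0 \<le> p" "p \<le> 1" and A: "finite A" "\<And>t. t \<in> A \<Longrightarrow> S t \<subseteq> U"
    and c: "\<And>t. t \<in> A \<Longrightarrow> 0 \<le> c t" and l: "0 \<le> l" and "0 < \<Delta>"
    and \<tau>: "\<tau> = (\<Sum>t\<in>A. c t * p ^ card (S t))"
    and \<Delta>: "(\<Sum>t\<in>A. \<Sum>u\<in>{u \<in> A. S t \<inter> S u \<noteq> {}}. c t * c u * p ^ card (S t \<union> S u)) \<le> \<Delta>"
  shows "measure_pmf.prob (random_subset_pmf U p) {W. weighted_containment A c S W \<le> \<tau> - l}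
    \<le> exp (- (l\<^sup>2 / (2 * \<Delta>)))"
proof -
  let ?E = "subset_expectation U p"
  let ?X = "weighted_containment A c S"
  \<comment> \<open>This value minimises the exponent
    \<open>s\<^sup>2 * \<Delta> / 2 - s * l\<close>.\<close>
  define s where "s = l / \<Delta>"
  have s: "0 \<le> s"
    using l \<open>0 < \<Delta>\<close> by (simp add: s_def)
  have "measure_pmf.prob (random_subset_pmf U p) {W. ?X W \<le> \<tau> - l}
      = ?E (indicator {W. ?X W \<le> \<tau> - l})"
    by simp
  also have "\<dots> \<le> ?E (\<lambda>W. exp (s * (\<tau> - l)) * exp (- s * ?X W))"
  proof (intro subset_expectation_mono U)
    fix W
    have "?X W \<le> \<tau> - l \<Longrightarrow> 1 \<le> exp (s * (\<tau> - l) + - s * ?X W)"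
      using mult_left_mono[OF _ s, of "?X W" "\<tau> - l"] by simp
    then show "indicator {W. ?X W \<le> \<tau> - l} W \<le> exp (s * (\<tau> - l)) * exp (- s * ?X W)"
      by (auto simp: indicator_def simp flip: exp_add)
  qed
  also have "\<dots> = exp (s * (\<tau> - l)) * ?E (\<lambda>W. exp (- s * ?X W))"
    by simp
  also have "\<dots> \<le> exp (s * (\<tau> - l)) * exp (s\<^sup>2 * \<Delta> / 2 - s * \<tau>)"
    by (intro mult_left_mono laplace_weighted_containment assms s) auto
  also have "\<dots> = exp (- (l\<^sup>2 / (2 * \<Delta>)))"
    using \<open>0 < \<Delta>\<close> unfolding exp_add[symmetric]
    by (simp add: s_def field_simps power2_eq_square)
  finally show ?thesis .
qed

section \<open>The overlap sum of a ranked-spread system\<close>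

text \<open>This bounds the contribution of a single \<open>t\<close>, because the ordering supplied
  by the spread condition may change with \<open>t\<close>. The weighted sum over \<open>t\<close>
  then yields the factor \<open>\<tau>\<close>.\<close>

lemma ranked_spread_overlap:
  fixes m k \<alpha> p :: real
  assumes sys: "weighted_set_system U T \<mu> P" and spread: "ranked_spread m k T \<mu> P"
    and A: "A \<subseteq> T" and t: "t \<in> T" and r: "card (P t) \<le> r"
    and pos: "0 < m" "0 < k" "0 < \<alpha>" and p: "p = \<alpha> / k" "p \<le> 1"
  shows "(\<Sum>s\<in>{s \<in> A. P t \<inter> P s \<noteq> {}}. pmf \<mu> s * p powi (- int (card (P t \<inter> P s)))) \<le> m * H_sum r \<alpha>"
proof (cases "P t = {}")
  case True
  have "0 \<le> m * H_sum r \<alpha>"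
    using pos by (auto simp: H_sum_def intro!: mult_nonneg_nonneg sum_nonneg)
  then show ?thesis
    using True by simp
next
  case False
  have finT: "finite T"
    using sys by (auto simp: weighted_set_system_def)
  have p0: "0 < p"
    using pos p by simp
  let ?n = "card (P t)"
  obtain x where x: "bij_betw x {1..?n} (P t)"
    and sp: "\<And>i. i \<in> {1..?n} \<Longrightarrow> measure_pmf.prob \<mu> {s\<in>T. x i \<in> P s} \<le> m * k powi (- int i)"
    using spread t False unfolding ranked_spread_def by blast
  have pointwise: "p powi (- int (card (P t \<inter> P s))) \<le> (\<Sum>i=1..?n. p powi (- int i) * of_bool (x i \<in> P s))"
    if "P t \<inter> P s \<noteq> {}" for s
  proof -
    define J where "J = {i\<in>{1..?n}. x i \<in> P s}"
    have img: "P t \<inter> P s = x ` J"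
      unfolding J_def by (subst (1) bij_betw_imp_surj_on[OF x, symmetric]) auto
    have J: "finite J" "J \<noteq> {}"
      using that img by (auto simp: J_def)
    then have "Max J \<in> J"
      by simp
    have "card (P t \<inter> P s) \<le> card J"
      using img J card_image_le by metis
    \<comment> \<open>Ranks start at 1, so this interval has exactly \<open>Max J\<close> elements;
      with \<open>p \<le> 1\<close> a larger exponent then gives a larger inverse power.\<close>
    also have "\<dots> \<le> card {1..Max J}"
      using J by (intro card_mono) (auto simp: J_def)
    finally have "p powi (- int (card (P t \<inter> P s))) \<le> p powi (- int (Max J))"
      using p p0 by (simp add: power_int_minus le_imp_inverse_le power_decreasing)
    also have "\<dots> = p powi (- int (Max J)) * of_bool (x (Max J) \<in> P s)"
      using \<open>Max J \<in> J\<close> by (simp add: J_def)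
    also have "\<dots> \<le> (\<Sum>i=1..?n. p powi (- int i) * of_bool (x i \<in> P s))"
      using \<open>Max J \<in> J\<close> p0
      by (intro member_le_sum[where f = "\<lambda>i. p powi (- int i) * of_bool (x i \<in> P s)"])
         (auto simp: J_def)
    finally show ?thesis .
  qed
  have "(\<Sum>s\<in>{s \<in> A. P t \<inter> P s \<noteq> {}}. pmf \<mu> s * p powi (- int (card (P t \<inter> P s))))
      \<le> (\<Sum>s\<in>{s \<in> A. P t \<inter> P s \<noteq> {}}. pmf \<mu> s * (\<Sum>i=1..?n. p powi (- int i) * of_bool (x i \<in> P s)))"
    by (intro sum_mono mult_left_mono pointwise) auto
  \<comment> \<open>All terms are nonnegative, so the sum may run over all of \<open>T\<close>;
    after swapping the sums, the inner one is the probability in the spread condition.\<close>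
  also have "\<dots> \<le> (\<Sum>s\<in>T. pmf \<mu> s * (\<Sum>i=1..?n. p powi (- int i) * of_bool (x i \<in> P s)))"
    using A finT p0 by (intro sum_mono2) (auto intro!: mult_nonneg_nonneg sum_nonneg)
  also have "\<dots> = (\<Sum>i=1..?n. p powi (- int i) * (\<Sum>s\<in>T. pmf \<mu> s * of_bool (x i \<in> P s)))"
    unfolding sum_distrib_left by (subst sum.swap) (simp add: mult_ac)
  also have "\<dots> = (\<Sum>i=1..?n. p powi (- int i) * measure_pmf.prob \<mu> {s\<in>T. x i \<in> P s})"
  proof -
    have "(\<Sum>s\<in>T. pmf \<mu> s * of_bool (Q s)) = measure_pmf.prob \<mu> {s\<in>T. Q s}" for Q
      using finT by (simp add: measure_measure_pmf_finite sum.If_cases of_bool_def if_distrib Int_def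
          cong: if_cong)
    then show ?thesis
      by simp
  qed
  also have "\<dots> \<le> (\<Sum>i=1..?n. p powi (- int i) * (m * k powi (- int i)))"
    using p0 by (intro sum_mono mult_left_mono sp) auto
  \<comment> \<open>Since \<open>p * k = \<alpha>\<close>, the powers of \<open>p\<close> and
    \<open>k\<close> combine into powers of \<open>\<alpha>\<close>.\<close>
  also have "\<dots> = m * (\<Sum>i=1..?n. \<alpha> powi (- int i))"
    unfolding sum_distrib_left using pos p
    by (intro sum.cong) (auto simp: power_int_minus field_simps)
  also have "\<dots> \<le> m * H_sum r \<alpha>"
    using r pos unfolding H_sum_def by (intro mult_left_mono sum_mono2) auto
  finally show ?thesis .
qed

theorem theorem3p3:
  fixes m k \<alpha> p \<tau> :: real and r :: nat
    and U :: "'a set" and T A :: "'t set" and \<mu> :: "'t pmf" and P :: "'t \<Rightarrow> 'a set"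
  assumes "m > 0" and "k > 0" and "r \<ge> 1"
    and "finite U"
    and "weighted_set_system U T \<mu> P"
    and "ranked_spread m k T \<mu> P"
    and "\<And>t. t \<in> T \<Longrightarrow> card (P t) \<le> r"
    and "A \<subseteq> T" and "\<tau> = measure_pmf.prob \<mu> A"
    and "\<alpha> > 0" and "p = \<alpha> / k" and "p \<le> 1"
  shows "measure_pmf.expectation (random_subset_pmf U p) (weighted_count \<mu> P p A) = \<tau>
    \<and> measure_pmf.variance (random_subset_pmf U p) (weighted_count \<mu> P p A) \<le> \<tau> * m * H_sum r \<alpha>
    \<and> (\<forall>\<eta>\<in>{0..1}.
         measure_pmf.prob (random_subset_pmf U p) {W. weighted_count \<mu> P p A W \<le> (1 - \<eta>) * \<tau>}
           \<le> exp (- (\<eta>\<^sup>2 * \<tau> / (2 * m * H_sum r \<alpha>))))"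
proof -
  \<comment> \<open>The normalisation makes each summand of the count have mean
    \<open>pmf \<mu> t\<close>.\<close>
  define c where "c t = pmf \<mu> t * p powi (- int (card (P t)))" for t
  let ?X = "weighted_containment A c P"
  let ?\<Delta> = "\<tau> * m * H_sum r \<alpha>"
  have p0: "0 < p"
    using assms by simp
  have finA: "finite A" and PU: "\<And>t. t \<in> A \<Longrightarrow> P t \<subseteq> U"
    using assms(5,8) finite_subset by (auto simp: weighted_set_system_def)
  have finP: "finite (P t)" if "t \<in> A" for t
    using PU[OF that] assms(4) finite_subset by blast
  have X: "weighted_count \<mu> P p A = ?X"
    by (auto simp: weighted_count_def weighted_containment_def c_def)
  have c0: "0 \<le> c t" for t
    using p0 by (simp add: c_def)
  have \<tau>: "\<tau> = (\<Sum>t\<in>A. pmf \<mu> t)"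
    using assms(9) finA by (simp add: measure_measure_pmf_finite)
  have cp: "c t * p ^ card (P t) = pmf \<mu> t" for t
    using p0 by (simp add: c_def power_int_minus)
  have EX: "subset_expectation U p ?X = \<tau>"
    using assms(4,12) p0 PU by (simp add: expectation_weighted_containment cp \<tau>)
  \<comment> \<open>By inclusion-exclusion for cardinalities, the joint containment probability
    divided by the two separate ones is the inverse power of \<open>p\<close> at the size of the
    overlap.\<close>
  have cc: "c t * c s * p ^ card (P t \<union> P s) = pmf \<mu> t * (pmf \<mu> s * p powi (- int (card (P t \<inter> P s))))"
    if "t \<in> A" "s \<in> A" for t s
  proof -
    have "p ^ card (P t \<union> P s) * p ^ card (P t \<inter> P s) = p ^ card (P t) * p ^ card (P s)"
      using card_Un_Int[OF finP finP, OF that] by (simp flip: power_add)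
    then show ?thesis
      using p0 by (simp add: c_def power_int_minus field_simps)
  qed
  have \<Delta>: "(\<Sum>t\<in>A. \<Sum>s\<in>{s \<in> A. P t \<inter> P s \<noteq> {}}. c t * c s * p ^ card (P t \<union> P s)) \<le> ?\<Delta>"
  proof -
    have "(\<Sum>t\<in>A. \<Sum>s\<in>{s \<in> A. P t \<inter> P s \<noteq> {}}. c t * c s * p ^ card (P t \<union> P s)) =
        (\<Sum>t\<in>A. pmf \<mu> t *
          (\<Sum>s\<in>{s \<in> A. P t \<inter> P s \<noteq> {}}. pmf \<mu> s * p powi (- int (card (P t \<inter> P s)))))"
      unfolding sum_distrib_left by (intro sum.cong refl cc) auto
    also have "\<dots> \<le> (\<Sum>t\<in>A. pmf \<mu> t * (m * H_sum r \<alpha>))"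
      using assms by (intro sum_mono mult_left_mono ranked_spread_overlap[where U = U and T = T]) auto
    finally show ?thesis
      by (simp add: \<tau> sum_distrib_right mult.assoc)
  qed
  have "measure_pmf.variance (random_subset_pmf U p) ?X \<le> ?\<Delta>"
  proof -
    have "measure_pmf.variance (random_subset_pmf U p) ?X = subset_expectation U p (\<lambda>W. (?X W)\<^sup>2) - \<tau>\<^sup>2"
      using assms(4) by (subst measure_pmf.variance_eq) (auto simp: EX)
    also have "\<dots> = (\<Sum>t\<in>A. \<Sum>s\<in>A. c t * c s * p ^ card (P t \<union> P s) - pmf \<mu> t * pmf \<mu> s)"
      using assms(4,12) p0 PU
      by (subst expectation_weighted_containment_square)
         (simp_all add: sum_subtractf \<tau> power2_eq_square sum_product)
    \<comment> \<open>By \<open>cc\<close>, a disjoint pair has covariance term exactly zero; for an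
      overlapping pair the subtracted product is nonnegative and is dropped.\<close>
    also have "\<dots> \<le> (\<Sum>t\<in>A. \<Sum>s\<in>A. if P t \<inter> P s \<noteq> {} then c t * c s * p ^ card (P t \<union> P s) else 0)"
      by (intro sum_mono) (auto simp: cc)
    also have "\<dots> = (\<Sum>t\<in>A. \<Sum>s\<in>{s \<in> A. P t \<inter> P s \<noteq> {}}. c t * c s * p ^ card (P t \<union> P s))"
      using finA by (intro sum.cong refl sum.inter_filter[symmetric])
    finally show ?thesis
      using \<Delta> by linarith
  qed
  moreover have "measure_pmf.prob (random_subset_pmf U p) {W. ?X W \<le> (1 - \<eta>) * \<tau>}
      \<le> exp (- (\<eta>\<^sup>2 * \<tau> / (2 * m * H_sum r \<alpha>)))" if \<eta>: "\<eta> \<in> {0..1}" for \<eta>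
  \<comment> \<open>For \<open>\<tau> = 0\<close> the claimed bound is \<open>exp 0 = 1\<close>.
    Otherwise the overlap bound is positive, as the lower-tail inequality requires.\<close>
  proof (cases "\<tau> = 0")
    case True
    then show ?thesis
      by simp
  next
    case False
    then have "0 < \<tau>"
      using assms(9) by (simp add: zero_less_measure_iff)
    \<comment> \<open>The hypothesis \<open>r \<ge> 1\<close> makes this sum of positive terms
      nonempty.\<close>
    moreover have H: "0 < H_sum r \<alpha>"
      unfolding H_sum_def using assms by (intro sum_pos) auto
    \<comment> \<open>The deviation is \<open>l = \<eta> * \<tau>\<close>; one factor
      \<open>\<tau>\<close> of \<open>l\<^sup>2\<close> cancels against the overlap bound.\<close>
    ultimately have "measure_pmf.prob (random_subset_pmf U p) {W. ?X W \<le> \<tau> - \<eta> * \<tau>}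
        \<le> exp (- ((\<eta> * \<tau>)\<^sup>2 / (2 * ?\<Delta>)))"
      using assms(1,4,12) p0 finA PU c0 \<eta> \<Delta>
      by (intro janson_lower_tail) (auto simp: cp \<tau>[symmetric])
    also have "(\<eta> * \<tau>)\<^sup>2 / (2 * ?\<Delta>) = \<eta>\<^sup>2 * \<tau> / (2 * m * H_sum r \<alpha>)"
      using \<open>0 < \<tau>\<close> H assms(1) by (simp add: field_simps power2_eq_square)
    finally show ?thesis
      by (simp add: algebra_simps)
  qed
  ultimately show ?thesis
    by (simp add: X EX)
qed

end
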